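(* Let $\varphi_e$ and $\varphi_{e_1}$ be two ruled surfaces in $\mathbb{R}^3$ that form a Bertrand surface offset, with offset angle $\theta$ and offset distance $\theta^*$. Then the dual curvature $\bar R_1$ of $\varphi_{e_1}$ is given by $$\bar R_1=\left[1+A^2\right]^{-1/2}-\varepsilon B\left[1+A^2\right]^{-3/2},$$ where $$A=\frac{ds}{ds_1}(\gamma\cos\theta-\sin\theta),$$ $$B=A\,\frac{ds}{ds_1}\Big[-(\sin\theta+A\cos\theta)\Delta+(\cos\theta-A\sin\theta)\delta-\big(A(\gamma\cos\theta-\sin\theta)+\cos\theta+\gamma\sin\theta\big)\theta^*\Big].$$
   Context: Dual numbers are $\bar a=a+\varepsilon a^*$ with $a,a^*\in\mathbb{R}$, $\varepsilon\neq 0$, $\varepsilon^2=0$. For a differentiable real function $f$, $f(x+\varepsilon x^* )=f(x)+\varepsilon x^*f'(x)$; e.g. $\cos(x+\varepsilon x^* )=\cos x-\varepsilon x^*\sin x$, $\sin(x+\varepsilon x^* )=\sin x+\varepsilon x^*\cos x$, $\sqrt{x+\varepsilon x^*}=\sqrt x+\varepsilon\frac{x^*}{2\sqrt x}$ for $x>0$. Dual vectors are $\tilde a=\vec a+\varepsilon\vec a^*$ with $\vec a,\vec a^*\in\mathbb{R}^3$; scalar and vector products are extended $\varepsilon$-bilinearly. A ruled surface $\varphi_e=\vec c(s)+v\,\vec e(s)$ (all data smooth) is parametrized so that $\langle \vec e,\vec e\rangle=1$, $\langle \vec e',\vec e'\rangle=1$, $\langle \vec c',\vec e'\rangle=0$,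 where prime is $d/ds$; so $s$ is the arc length of the real indicatrix $\vec e(s)$ and $\vec c$ is the striction line. It is represented by the dual unit vector $\tilde e=\vec e+\varepsilon\,\vec c\times\vec e$. Put $\vec t=\vec e'$, $\vec g=\vec e\times\vec t$; the conical curvature $\gamma$ is defined by $\vec e'=\vec t$, $\vec t'=\gamma\vec g-\vec e$, $\vec g'=-\gamma\vec t$. Put $\Delta=\det(\vec c',\vec e,\vec t)$, $\delta=\langle\vec c',\vec e\rangle$. The dual Darboux frame is $\{\tilde e,\tilde t,\tilde g\}$ with $\tilde t=\vec t+\varepsilon\,\vec c\times\vec t$, $\tilde g=\vec g+\varepsilon\,\vec c\times\vec g$. The dual conical curvature is $\bar\gamma=\gamma+\varepsilon(\delta-\gamma\Delta)$ and the dual curvature is $\bar R=1/\sqrt{1+\bar\gamma^2}$. The corresponding objects of a second ruled surface $\varphi_{e_1}$ (with its own parameter $s_1$, derivatives taken with respect to $s_1$) carry the subscript $1$; so $\bar R_1=1/\sqrt{1+\bar\gamma_1^2}$. $\varphi_e$ and $\varphi_{e_1}$ form a Bertrand surface offset if, under a correspondence $s_1=s_1(s)$ between their rulings (differentiable with nonvanishing derivative), $\tilde t=\tilde t_1$ at corresponding parameters. The frames are then related by $\tilde e_1=\cos\bar\theta\,\tilde e-\sin\bar\theta\,\tilde g$, $\tilde t_1=\tilde t$, $\tilde g_1=\sin\bar\theta\,\tilde e+\cos\bar\theta\,\tilde g$, where $\bar\theta=\theta+\varepsilon\theta^*$ ($0\le\theta\le\pi$, $\theta^*\in\mathbb{R}$)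 is the dual angle between $\tilde e$ and $\tilde e_1$; $\theta$ is the offset angle and $\theta^*$ the offset distance. $ds/ds_1$ is the derivative of the inverse correspondence $s=s(s_1)$. *)

theory Defs
  imports "HOL-Analysis.Analysis"
begin

unbundle cross3_syntax

section \<open>Dual numbers and dual vectors\<close>

datatype 'a dual = Dual (real_part: 'a) (dual_part: 'a)

text \<open>
  \<open>Dual a b\<close> stands for \<open>a + \<epsilon> b\<close> with \<open>\<epsilon>\<^sup>2 = 0\<close>. Dual numbers are the elements of
  \<^typ>\<open>real dual\<close>, dual vectors those of \<^typ>\<open>(real^3) dual\<close>.
\<close>

instantiation dual :: (ab_group_add) ab_group_add
begin

definition "0 = Dual 0 0"
definition "x + y = Dual (real_part x + real_part y) (dual_part x + dual_part y)"
definition "x - y = Dual (real_part x - real_part y) (dual_part x - dual_part y)"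
definition "- x = Dual (- real_part x) (- dual_part x)"

instance
  by standard
    (auto simp: zero_dual_def plus_dual_def minus_dual_def uminus_dual_def algebra_simps)

end

instantiation dual :: (comm_ring_1) comm_ring_1
begin

definition "1 = Dual 1 0"
definition "x * y = Dual (real_part x * real_part y)
                         (real_part x * dual_part y + dual_part x * real_part y)"

instance
  by standard
    (auto simp: zero_dual_def one_dual_def plus_dual_def times_dual_def algebra_simps)

end

text \<open>
  The inverse is meaningful only when the real part is nonzero, see \<open>dual_inverse_right\<close>.
\<close>

instantiation dual :: (field) inverse
begin

definition "inverse x = Dual (inverse (real_part x)) (- dual_part x / (real_part x)\<^sup>2)"
definition "x div y = x * inverse (y :: 'a dual)"

instance ..

end

lemma dual_inverse_right:
  fixes x :: "'a::field dual"
  assumes "real_part x \<noteq> 0"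
  shows "x * inverse x = 1"
  using assms
  by (simp add: inverse_dual_def times_dual_def one_dual_def field_simps power2_eq_square)

text \<open>The extension \<open>f(x + \<epsilon> y) = f(x) + \<epsilon> y f'(x)\<close> of a real function to dual numbers.\<close>

definition dual_ext :: "(real \<Rightarrow> real) \<Rightarrow> real dual \<Rightarrow> real dual" where
  "dual_ext f x = Dual (f (real_part x)) (dual_part x * deriv f (real_part x))"

definition dual_scale :: "real dual \<Rightarrow> (real^3) dual \<Rightarrow> (real^3) dual" where
  "dual_scale a x = Dual (real_part a *\<^sub>R real_part x)
                         (real_part a *\<^sub>R dual_part x + dual_part a *\<^sub>R real_part x)"

text \<open>The dual vector of the oriented line through the point \<open>p\<close> with direction \<open>x\<close>.\<close>

definition dual_line :: "real^3 \<Rightarrow> real^3 \<Rightarrow> (real^3) dual" where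
  "dual_line p x = Dual x (p \<times> x)"

section \<open>Ruled surfaces\<close>

abbreviation curve_deriv :: "(real \<Rightarrow> real^3) \<Rightarrow> real \<Rightarrow> real^3" where
  "curve_deriv f \<equiv> (\<lambda>s. vector_derivative f (at s))"

definition smooth_curve_on :: "real set \<Rightarrow> (real \<Rightarrow> real^3) \<Rightarrow> bool" where
  "smooth_curve_on I f \<longleftrightarrow> (\<forall>n. \<forall>s\<in>I. (curve_deriv ^^ n) f differentiable (at s))"

text \<open>
  The surface \<open>(s, v) \<mapsto> c(s) + v e(s)\<close>, with \<open>s\<close> in the open interval \<open>I\<close>, is given by its
  striction line \<open>c\<close> and its rulings \<open>e\<close>, parametrized by the arc length of \<open>e\<close>.
\<close>

definition ruled_surface :: "real set \<Rightarrow> (real \<Rightarrow> real^3) \<Rightarrow> (real \<Rightarrow> real^3) \<Rightarrow> bool" where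
  "ruled_surface I c e \<longleftrightarrow>
     open I \<and> is_interval I \<and> I \<noteq> {} \<and> smooth_curve_on I c \<and> smooth_curve_on I e \<and>
     (\<forall>s\<in>I. e s \<bullet> e s = 1 \<and>
            curve_deriv e s \<bullet> curve_deriv e s = 1 \<and>
            curve_deriv c s \<bullet> curve_deriv e s = 0)"

definition central_normal :: "(real \<Rightarrow> real^3) \<Rightarrow> real \<Rightarrow> real^3" where
  "central_normal e s = curve_deriv e s"

definition asymptotic_normal :: "(real \<Rightarrow> real^3) \<Rightarrow> real \<Rightarrow> real^3" where
  "asymptotic_normal e s = e s \<times> central_normal e s"

text \<open>
  The coefficient \<open>k\<close> in the Frenet equations \<open>t' = k g - e\<close> and \<open>g' = - k t\<close>, where
  \<open>t = e'\<close> and \<open>g = e \<times> t\<close>; it exists and is unique on a \<^const>\<open>ruled_surface\<close>.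
\<close>

definition conical_curvature :: "(real \<Rightarrow> real^3) \<Rightarrow> real \<Rightarrow> real" where
  "conical_curvature e s =
     (THE k. curve_deriv (central_normal e) s = k *\<^sub>R asymptotic_normal e s - e s \<and>
             curve_deriv (asymptotic_normal e) s = - k *\<^sub>R central_normal e s)"

definition Delta :: "(real \<Rightarrow> real^3) \<Rightarrow> (real \<Rightarrow> real^3) \<Rightarrow> real \<Rightarrow> real" where
  "Delta c e s = det (vector [curve_deriv c s, e s, central_normal e s] :: real^3^3)"

definition delta :: "(real \<Rightarrow> real^3) \<Rightarrow> (real \<Rightarrow> real^3) \<Rightarrow> real \<Rightarrow> real" where
  "delta c e s = curve_deriv c s \<bullet> e s"

definition dual_ruling :: "(real \<Rightarrow> real^3) \<Rightarrow> (real \<Rightarrow> real^3) \<Rightarrow> real \<Rightarrow> (real^3) dual" where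
  "dual_ruling c e s = dual_line (c s) (e s)"

definition dual_central_normal ::
    "(real \<Rightarrow> real^3) \<Rightarrow> (real \<Rightarrow> real^3) \<Rightarrow> real \<Rightarrow> (real^3) dual" where
  "dual_central_normal c e s = dual_line (c s) (central_normal e s)"

definition dual_asymptotic_normal ::
    "(real \<Rightarrow> real^3) \<Rightarrow> (real \<Rightarrow> real^3) \<Rightarrow> real \<Rightarrow> (real^3) dual" where
  "dual_asymptotic_normal c e s = dual_line (c s) (asymptotic_normal e s)"

definition dual_conical_curvature ::
    "(real \<Rightarrow> real^3) \<Rightarrow> (real \<Rightarrow> real^3) \<Rightarrow> real \<Rightarrow> real dual" where
  "dual_conical_curvature c e s =
     Dual (conical_curvature e s) (delta c e s - conical_curvature e s * Delta c e s)"

definition dual_curvature ::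
    "(real \<Rightarrow> real^3) \<Rightarrow> (real \<Rightarrow> real^3) \<Rightarrow> real \<Rightarrow> real dual" where
  "dual_curvature c e s = 1 / dual_ext sqrt (1 + (dual_conical_curvature c e s)\<^sup>2)"

section \<open>Bertrand offsets\<close>

text \<open>The map \<open>\<phi>\<close> is the correspondence \<open>s\<^sub>1 = \<phi>(s)\<close> between the rulings.\<close>

definition bertrand_offset ::
    "real set \<Rightarrow> (real \<Rightarrow> real^3) \<Rightarrow> (real \<Rightarrow> real^3) \<Rightarrow>
     real set \<Rightarrow> (real \<Rightarrow> real^3) \<Rightarrow> (real \<Rightarrow> real^3) \<Rightarrow> (real \<Rightarrow> real) \<Rightarrow> bool" where
  "bertrand_offset I c e I\<^sub>1 c\<^sub>1 e\<^sub>1 \<phi> \<longleftrightarrow>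
     ruled_surface I c e \<and> ruled_surface I\<^sub>1 c\<^sub>1 e\<^sub>1 \<and>
     bij_betw \<phi> I I\<^sub>1 \<and>
     (\<forall>s\<in>I. \<phi> differentiable (at s) \<and> deriv \<phi> s \<noteq> 0) \<and>
     (\<forall>s\<in>I. dual_central_normal c e s = dual_central_normal c\<^sub>1 e\<^sub>1 (\<phi> s))"

text \<open>
  \<open>\<theta> + \<epsilon> \<theta>'\<close> is the dual angle from the rulings of the first surface to those of the second.
  It is not assumed to be constant along the surface. For a Bertrand offset the corresponding
  relation \<open>g\<^sub>1 = sin(\<theta> + \<epsilon> \<theta>') e + cos(\<theta> + \<epsilon> \<theta>') g\<close> between the dual vectors follows
  from the one below by taking the dual cross product with the common central normal.
\<close>

definition offset_dual_angle ::
    "real set \<Rightarrow> (real \<Rightarrow> real^3) \<Rightarrow> (real \<Rightarrow> real^3) \<Rightarrow>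
     (real \<Rightarrow> real^3) \<Rightarrow> (real \<Rightarrow> real^3) \<Rightarrow> (real \<Rightarrow> real) \<Rightarrow>
     (real \<Rightarrow> real) \<Rightarrow> (real \<Rightarrow> real) \<Rightarrow> bool" where
  "offset_dual_angle I c e c\<^sub>1 e\<^sub>1 \<phi> \<theta> \<theta>' \<longleftrightarrow>
     (\<forall>s\<in>I. 0 \<le> \<theta> s \<and> \<theta> s \<le> pi \<and>
        dual_ruling c\<^sub>1 e\<^sub>1 (\<phi> s) =
          dual_scale (dual_ext cos (Dual (\<theta> s) (\<theta>' s))) (dual_ruling c e s) -
          dual_scale (dual_ext sin (Dual (\<theta> s) (\<theta>' s))) (dual_asymptotic_normal c e s))"

end

theory Submission
  imports Defs
begin

text \<open>
  A dual unit vector encodes an oriented line, so the single equation between the dual central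
  normals of a Bertrand offset says two things: the unit vectors \<open>t\<close> and \<open>t\<^sub>1\<close> agree, and the
  striction points \<open>c\<close> and \<open>c\<^sub>1\<close> lie on one common line in the direction \<open>t\<close>. Comparing the
  real and dual parts of the relation defining the dual angle \<open>\<theta> + \<epsilon> \<theta>'\<close>, the second frame arises
  from the first by a screw motion about that line, rotating by \<open>\<theta>\<close> and sliding by \<open>\<theta>'\<close>
  (\<open>offset_frame\<close>):
  \<open>e\<^sub>1 = cos \<theta> e - sin \<theta> g\<close>, \<open>g\<^sub>1 = sin \<theta> e + cos \<theta> g\<close> and \<open>c\<^sub>1 = c + \<theta>' t\<close>.

  Here \<open>\<theta>'\<close> is the offset distance, while a prime on a vector denotes a derivative.
  Write \<open>r = ds/ds\<^sub>1\<close>. Differentiating \<open>t\<^sub>1 = t\<close> and \<open>c\<^sub>1 = c + \<theta>' t\<close> along the correspondence and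
  using the Frenet equation \<open>t' = \<gamma> g - e\<close> gives
  \<open>t\<^sub>1' = r (\<gamma> g - e)\<close> and \<open>c\<^sub>1' = r (c' + \<theta>' (\<gamma> g - e) + d t)\<close>
  with some scalar \<open>d\<close> (\<open>offset_derivatives\<close>). The invariants of the second surface are inner
  products of these vectors with \<open>e\<^sub>1\<close> and \<open>g\<^sub>1\<close>: \<open>\<gamma>\<^sub>1 = \<langle>t\<^sub>1', g\<^sub>1\<rangle>\<close>, \<open>\<delta>\<^sub>1 = \<langle>c\<^sub>1', e\<^sub>1\<rangle>\<close> and
  \<open>\<Delta>\<^sub>1 = \<langle>c\<^sub>1', g\<^sub>1\<rangle>\<close>. Both \<open>e\<^sub>1\<close> and \<open>g\<^sub>1\<close> are orthogonal to \<open>t\<close>, so the term with \<open>d\<close>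
  vanishes, and what remains are linear expressions in \<open>\<gamma>\<close>, \<open>\<delta>\<close>, \<open>\<Delta>\<close>, \<open>\<theta>'\<close>
  (\<open>offset_invariants\<close>). In particular \<open>\<gamma>\<^sub>1 = A\<close> and \<open>A (\<delta>\<^sub>1 - \<gamma>\<^sub>1 \<Delta>\<^sub>1) = B\<close>, and the theorem is
  the first order expansion of \<open>1 / sqrt (1 + x\<^sup>2)\<close> at \<open>x = \<gamma>\<^sub>1 + \<epsilon> (\<delta>\<^sub>1 - \<gamma>\<^sub>1 \<Delta>\<^sub>1)\<close>
  (\<open>dual_curvature_eq\<close>).
\<close>

section \<open>Orthonormal frames\<close>

lemma orthonormal_cross:
  fixes x y :: "real^3"
  assumes "x \<bullet> x = 1" "y \<bullet> y = 1" "x \<bullet> y = 0"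
  shows "(x \<times> y) \<bullet> (x \<times> y) = 1" "(x \<times> y) \<bullet> x = 0" "(x \<times> y) \<bullet> y = 0"
    and "x \<times> (x \<times> y) = - y" "y \<times> (x \<times> y) = x"
  using assms by (simp_all add: dot_cross Lagrange dot_cross_self inner_commute)

text \<open>
  The difference \<open>w\<close> of the two sides is orthogonal to \<open>x\<close>, \<open>y\<close> and \<open>x \<times> y\<close>. The Lagrange
  identity turns the first two relations into \<open>w \<times> (x \<times> y) = 0\<close>, and a vector that is both
  orthogonal and parallel to a nonzero vector is zero.
\<close>

lemma orthonormal_expansion:
  fixes x y z :: "real^3"
  assumes "x \<bullet> x = 1" "y \<bullet> y = 1" "x \<bullet> y = 0"
  shows "z = (z \<bullet> x) *\<^sub>R x + (z \<bullet> y) *\<^sub>R y + (z \<bullet> (x \<times> y)) *\<^sub>R (x \<times> y)"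
proof -
  let ?n = "x \<times> y"
  define w where "w = z - ((z \<bullet> x) *\<^sub>R x + (z \<bullet> y) *\<^sub>R y + (z \<bullet> ?n) *\<^sub>R ?n)"
  note orth = assms orthonormal_cross(1-3)[OF assms]
  have wx: "w \<bullet> x = 0" and wy: "w \<bullet> y = 0" and wn: "?n \<bullet> w = 0"
    using orth by (simp_all add: w_def inner_diff_left inner_diff_right inner_add_left
        inner_add_right inner_commute)
  have "w \<times> ?n = 0"
    by (simp add: Lagrange wx wy)
  then have "?n \<times> w = 0"
    by (metis cross_skew neg_0_equal_iff_equal)
  moreover have "?n \<noteq> 0"
    using orth(4) by auto
  ultimately have "w = 0"
    using norm_and_cross_eq_0 wn by blast
  then show ?thesis
    by (simp add: w_def)
qed

section \<open>Frenet equations of the indicatrix\<close>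

lemma ruled_surface_has_derivs:
  assumes "ruled_surface I c e" "s \<in> I"
  shows "(c has_vector_derivative curve_deriv c s) (at s)"
    and "(e has_vector_derivative central_normal e s) (at s)"
    and "(central_normal e has_vector_derivative curve_deriv (central_normal e) s) (at s)"
proof -
  have "(curve_deriv ^^ 0) c differentiable at s" "(curve_deriv ^^ 0) e differentiable at s"
    "(curve_deriv ^^ 1) e differentiable at s"
    using assms unfolding ruled_surface_def smooth_curve_on_def by blast+
  moreover have "curve_deriv e = central_normal e"
    by (auto simp: central_normal_def)
  ultimately show "(c has_vector_derivative curve_deriv c s) (at s)"
    and "(e has_vector_derivative central_normal e s) (at s)"
    and "(central_normal e has_vector_derivative curve_deriv (central_normal e) s) (at s)"
    by (simp_all add: vector_derivative_works central_normal_def)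
qed

lemma has_vector_derivative_const_on_open:
  assumes "(f has_vector_derivative d) (at x)" "open S" "x \<in> S" "\<And>y. y \<in> S \<Longrightarrow> f y = k"
  shows "d = 0"
  using has_vector_derivative_transform_within_open[OF assms] has_vector_derivative_const
    vector_derivative_unique_at by blast

text \<open>
  Everything beyond the unit lengths comes from differentiating the constant functions
  \<open>\<langle>e, e\<rangle> = 1\<close>, \<open>\<langle>t, t\<rangle> = 1\<close> and then \<open>\<langle>e, t\<rangle> = 0\<close>.
\<close>

lemma ruled_surface_frame:
  assumes R: "ruled_surface I c e" and s: "s \<in> I"
  shows "e s \<bullet> e s = 1" "central_normal e s \<bullet> central_normal e s = 1"
    and "e s \<bullet> central_normal e s = 0"
    and "curve_deriv (central_normal e) s \<bullet> central_normal e s = 0"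
    and "curve_deriv (central_normal e) s \<bullet> e s = - 1"
proof -
  have I: "open I" using R by (simp add: ruled_surface_def)
  have ee: "e u \<bullet> e u = 1" and tt: "central_normal e u \<bullet> central_normal e u = 1" if "u \<in> I" for u
    using R that by (auto simp: ruled_surface_def central_normal_def)
  note D = ruled_surface_has_derivs[OF R]
  note prod = bounded_bilinear.has_vector_derivative[OF bounded_bilinear_inner]
  have et: "e u \<bullet> central_normal e u = 0" if "u \<in> I" for u
    using has_vector_derivative_const_on_open[OF prod[OF D(2) D(2)] I, OF that that that, of 1] ee
    by (simp add: inner_commute)
  show "e s \<bullet> e s = 1" "central_normal e s \<bullet> central_normal e s = 1"
    "e s \<bullet> central_normal e s = 0"
    using ee tt et s by auto
  show "curve_deriv (central_normal e) s \<bullet> central_normal e s = 0"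
    using has_vector_derivative_const_on_open[OF prod[OF D(3) D(3)] I, OF s s s, of 1] tt
    by (simp add: inner_commute)
  show "curve_deriv (central_normal e) s \<bullet> e s = - 1"
    using has_vector_derivative_const_on_open[OF prod[OF D(2) D(3)] I, OF s s s, of 0] et tt s
    by (simp add: inner_commute)
qed

text \<open>
  The definite description in the definition of the conical curvature has to be resolved. The
  first Frenet equation is the expansion of \<open>t'\<close> in the frame, where the coefficients along \<open>e\<close>
  and \<open>t\<close> are already known; the second follows from it by the product rule for \<open>g = e \<times> t\<close>.
  Uniqueness is the inner product of the first equation with \<open>g\<close>.
\<close>

lemma conical_curvature_eq:
  assumes R: "ruled_surface I c e" and s: "s \<in> I"
  shows "conical_curvature e s = curve_deriv (central_normal e) s \<bullet> asymptotic_normal e s"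
proof -
  define t where "t = central_normal e"
  define g where "g = asymptotic_normal e"
  define k where "k = curve_deriv t s \<bullet> g s"
  note F = ruled_surface_frame[OF R s, folded t_def]
  note C = orthonormal_cross[OF F(1-3)]
  have g_eq: "g u = e u \<times> t u" for u
    by (simp add: g_def t_def asymptotic_normal_def)
  have t': "curve_deriv t s = k *\<^sub>R g s - e s"
    using orthonormal_expansion[OF F(1-3), of "curve_deriv t s"] F(4,5)
    by (simp add: k_def g_eq)
  have bb: "bounded_bilinear (\<times>)"
    using bilinear_cross bilinear_conv_bounded_bilinear by blast
  have "((\<lambda>u. e u \<times> t u) has_vector_derivative e s \<times> curve_deriv t s + t s \<times> t s) (at s)"
    using bounded_bilinear.has_vector_derivative[OF bb ruled_surface_has_derivs(2,3)[OF R s]]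
    by (simp only: t_def)
  moreover have "e s \<times> curve_deriv t s + t s \<times> t s = - k *\<^sub>R t s"
    by (simp add: t' Cross3.right_diff_distrib cross_mult_right g_eq C)
  moreover have "g = (\<lambda>u. e u \<times> t u)"
    by (auto simp: g_eq)
  ultimately have g': "curve_deriv g s = - k *\<^sub>R t s"
    by (simp add: vector_derivative_at)
  have "l = k" if "curve_deriv t s = l *\<^sub>R g s - e s" for l
    using that C by (simp add: k_def g_eq inner_diff_left inner_diff_right inner_commute)
  then have "conical_curvature e s = k"
    unfolding conical_curvature_def t_def[symmetric] g_def[symmetric]
    using t' g' by (intro the_equality) auto
  then show ?thesis
    by (simp add: k_def t_def g_def)
qed

lemma Delta_eq_inner: "Delta c e s = curve_deriv c s \<bullet> asymptotic_normal e s"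
  by (simp add: Delta_def asymptotic_normal_def dot_cross_det)

section \<open>Dual curvature\<close>

lemma dual_curvature_eq:
  assumes "dual_conical_curvature c e s = Dual a b"
  shows "dual_curvature c e s =
    Dual ((1 + a\<^sup>2) powr (- 1 / 2)) (- (a * b) * (1 + a\<^sup>2) powr (- 3 / 2))"
proof -
  define q where "q = 1 + a\<^sup>2"
  have q: "q > 0"
    by (simp add: q_def add_pos_nonneg)
  have "1 + (Dual a b)\<^sup>2 = Dual q (2 * (a * b))"
    by (simp add: power2_eq_square one_dual_def plus_dual_def times_dual_def q_def)
  moreover have "deriv sqrt q = inverse (sqrt q) / 2"
    using q DERIV_imp_deriv DERIV_real_sqrt by blast
  ultimately have "dual_curvature c e s = Dual (1 / sqrt q) (- (a * b) * (1 / (sqrt q * q)))"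
    using q by (simp add: dual_curvature_def assms dual_ext_def divide_dual_def inverse_dual_def
        times_dual_def one_dual_def field_simps)
  moreover have "q powr (- 1 / 2) = 1 / sqrt q"
    using q by (simp add: powr_minus_divide powr_half_sqrt)
  moreover have "q powr (- 3 / 2) = 1 / (sqrt q * q)"
  proof -
    have "q powr (3 / 2) = q powr (1 / 2) * q powr 1"
      by (subst powr_add[symmetric]) simp
    then show ?thesis
      using q by (simp add: powr_minus_divide powr_half_sqrt)
  qed
  ultimately show ?thesis
    by (simp add: q_def)
qed

section \<open>Bertrand offsets\<close>

text \<open>
  The real part of the angle relation gives \<open>e\<^sub>1\<close>, and with it \<open>g\<^sub>1 = e\<^sub>1 \<times> t\<close>. For the striction
  points, equality of the moments \<open>c \<times> t = c\<^sub>1 \<times> t\<close> makes \<open>w = c\<^sub>1 - c\<close> a multiple \<open>l t\<close>. Then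
  \<open>w \<times> e\<^sub>1 = - l g\<^sub>1\<close>, while the dual part of the angle relation says \<open>w \<times> e\<^sub>1 = - \<theta>' g\<^sub>1\<close>;
  since \<open>g\<^sub>1 \<noteq> 0\<close>, \<open>l = \<theta>'\<close>.
\<close>

lemma offset_frame:
  assumes B: "bertrand_offset I c e I\<^sub>1 c\<^sub>1 e\<^sub>1 \<phi>"
    and O: "offset_dual_angle I c e c\<^sub>1 e\<^sub>1 \<phi> \<theta> \<theta>'"
    and s: "s \<in> I"
  shows "central_normal e\<^sub>1 (\<phi> s) = central_normal e s"
    and "e\<^sub>1 (\<phi> s) = cos (\<theta> s) *\<^sub>R e s - sin (\<theta> s) *\<^sub>R asymptotic_normal e s"
    and "asymptotic_normal e\<^sub>1 (\<phi> s) = sin (\<theta> s) *\<^sub>R e s + cos (\<theta> s) *\<^sub>R asymptotic_normal e s"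
    and "c\<^sub>1 (\<phi> s) = c s + \<theta>' s *\<^sub>R central_normal e s"
proof -
  have R: "ruled_surface I c e"
    using B by (simp add: bertrand_offset_def)
  define t where "t = central_normal e s"
  define g where "g = asymptotic_normal e s"
  define w where "w = c\<^sub>1 (\<phi> s) - c s"
  note F = ruled_surface_frame[OF R s, folded t_def]
  have g_eq: "g = e s \<times> t"
    by (simp add: g_def t_def asymptotic_normal_def)
  note C = orthonormal_cross[OF F(1-3), folded g_eq]
  have te: "t \<times> e s = - g"
    by (simp add: g_eq cross_skew[of t])
  have "dual_central_normal c e s = dual_central_normal c\<^sub>1 e\<^sub>1 (\<phi> s)"
    using B s by (simp add: bertrand_offset_def)
  then have t1: "central_normal e\<^sub>1 (\<phi> s) = t" and ct: "c s \<times> t = c\<^sub>1 (\<phi> s) \<times> t"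
    by (auto simp: dual_central_normal_def dual_line_def t_def)
  show "central_normal e\<^sub>1 (\<phi> s) = central_normal e s"
    using t1 by (simp add: t_def)
  have dc: "deriv cos x = - sin x" and ds: "deriv sin x = cos x" for x :: real
    by (auto intro!: DERIV_imp_deriv DERIV_cos DERIV_sin)
  have "dual_ruling c\<^sub>1 e\<^sub>1 (\<phi> s) =
          dual_scale (dual_ext cos (Dual (\<theta> s) (\<theta>' s))) (dual_ruling c e s) -
          dual_scale (dual_ext sin (Dual (\<theta> s) (\<theta>' s))) (dual_asymptotic_normal c e s)"
    using O s by (simp add: offset_dual_angle_def)
  then have e1: "e\<^sub>1 (\<phi> s) = cos (\<theta> s) *\<^sub>R e s - sin (\<theta> s) *\<^sub>R g"
    and ce: "c\<^sub>1 (\<phi> s) \<times> e\<^sub>1 (\<phi> s) = cos (\<theta> s) *\<^sub>R (c s \<times> e s) - (\<theta>' s * sin (\<theta> s)) *\<^sub>R e s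
      - (sin (\<theta> s) *\<^sub>R (c s \<times> g) + (\<theta>' s * cos (\<theta> s)) *\<^sub>R g)"
    by (auto simp add: dual_ruling_def dual_asymptotic_normal_def dual_line_def dual_ext_def
        dual_scale_def minus_dual_def dc ds g_def simp del: dual.collapse)
  show "e\<^sub>1 (\<phi> s) = cos (\<theta> s) *\<^sub>R e s - sin (\<theta> s) *\<^sub>R asymptotic_normal e s"
    using e1 by (simp add: g_def)
  have gt: "g \<times> t = - e s"
    using C(5) cross_skew by metis
  have g1: "asymptotic_normal e\<^sub>1 (\<phi> s) = sin (\<theta> s) *\<^sub>R e s + cos (\<theta> s) *\<^sub>R g"
    by (simp add: asymptotic_normal_def t1 e1 Cross3.left_diff_distrib cross_mult_left gt
        flip: g_eq)
  then show "asymptotic_normal e\<^sub>1 (\<phi> s) = sin (\<theta> s) *\<^sub>R e s + cos (\<theta> s) *\<^sub>R asymptotic_normal e s"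
    by (simp add: g_def)
  have "t \<times> w = 0"
    using ct cross_skew[of t w] by (simp add: w_def Cross3.left_diff_distrib)
  then have "t \<times> (t \<times> w) = 0"
    by simp
  then have w: "w = (w \<bullet> t) *\<^sub>R t"
    using F(2) by (simp add: Lagrange inner_commute)
  define l where "l = w \<bullet> t"
  have "w \<times> e\<^sub>1 (\<phi> s) = - \<theta>' s *\<^sub>R (sin (\<theta> s) *\<^sub>R e s + cos (\<theta> s) *\<^sub>R g)"
  proof -
    have "w \<times> e\<^sub>1 (\<phi> s) = c\<^sub>1 (\<phi> s) \<times> e\<^sub>1 (\<phi> s)
        - (cos (\<theta> s) *\<^sub>R (c s \<times> e s) - sin (\<theta> s) *\<^sub>R (c s \<times> g))"
      by (simp add: w_def Cross3.left_diff_distrib)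
        (simp add: e1 Cross3.right_diff_distrib cross_mult_right)
    then show ?thesis
      by (simp add: ce algebra_simps)
  qed
  moreover have "w \<times> e\<^sub>1 (\<phi> s) = - l *\<^sub>R (sin (\<theta> s) *\<^sub>R e s + cos (\<theta> s) *\<^sub>R g)"
    by (subst w) (simp add: e1 l_def cross_mult_left Cross3.right_diff_distrib cross_mult_right te C
        algebra_simps)
  moreover have "sin (\<theta> s) *\<^sub>R e s + cos (\<theta> s) *\<^sub>R g \<noteq> 0"
  proof
    assume z: "sin (\<theta> s) *\<^sub>R e s + cos (\<theta> s) *\<^sub>R g = 0"
    have "sin (\<theta> s) = 0" "cos (\<theta> s) = 0"
      using arg_cong[OF z, of "\<lambda>v. v \<bullet> e s"] arg_cong[OF z, of "\<lambda>v. v \<bullet> g"] F C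
      by (simp_all add: inner_add_left inner_add_right inner_commute)
    then show False
      using sin_cos_squared_add[of "\<theta> s"] by simp
  qed
  ultimately have "l = \<theta>' s"
    by (metis neg_equal_iff_equal scaleR_right_imp_eq)
  then show "c\<^sub>1 (\<phi> s) = c s + \<theta>' s *\<^sub>R central_normal e s"
    using w by (simp add: w_def l_def t_def algebra_simps)
qed

text \<open>
  The continuous injective map \<open>\<phi>\<close> on an open interval has a continuous inverse, so the
  derivative of the inverse is the reciprocal of the nonzero derivative of \<open>\<phi>\<close>.
\<close>

lemma offset_parameter_derivative:
  assumes B: "bertrand_offset I c e I\<^sub>1 c\<^sub>1 e\<^sub>1 \<phi>" and s: "s \<in> I"
  shows "(\<phi> has_real_derivative deriv \<phi> s) (at s)"
    and "deriv (inv_into I \<phi>) (\<phi> s) * deriv \<phi> s = 1"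
proof -
  have I: "open I" and bij: "bij_betw \<phi> I I\<^sub>1"
    and d: "\<And>u. u \<in> I \<Longrightarrow> \<phi> differentiable at u" and nz: "deriv \<phi> s \<noteq> 0"
    using B s by (auto simp: bertrand_offset_def ruled_surface_def)
  show D: "(\<phi> has_real_derivative deriv \<phi> s) (at s)"
    using d[OF s] by (simp add: DERIV_deriv_iff_real_differentiable)
  have cont: "continuous_on I \<phi>"
    using d differentiable_imp_continuous_within
    by (auto intro!: continuous_at_imp_continuous_on)
  have "(inv_into I \<phi> has_derivative (\<lambda>h. h / deriv \<phi> s)) (at (\<phi> s))"
  proof (rule has_derivative_inverse_strong[OF I s cont])
    show "inv_into I \<phi> (\<phi> u) = u" if "u \<in> I" for u
      using bij that by (simp add: bij_betw_def)
    show "(\<phi> has_derivative (\<lambda>h. h * deriv \<phi> s)) (at s)"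
      using D by (simp add: has_field_derivative_def mult_commute_abs)
    show "(\<lambda>h. h * deriv \<phi> s) \<circ> (\<lambda>h. h / deriv \<phi> s) = id"
      using nz by auto
  qed
  then have "(inv_into I \<phi> has_real_derivative 1 / deriv \<phi> s) (at (\<phi> s))"
    by (simp add: has_field_derivative_def) (simp add: divide_inverse mult_commute_abs)
  then show "deriv (inv_into I \<phi>) (\<phi> s) * deriv \<phi> s = 1"
    using nz by (simp add: DERIV_imp_deriv)
qed

text \<open>
  The relations of \<open>offset_frame\<close> hold on the whole open interval, so they can be differentiated.
  The offset distance \<open>\<theta>'\<close> is a differentiable function because it equals \<open>\<langle>c\<^sub>1 - c, t\<rangle>\<close>; the
  scalar \<open>d\<close> is its derivative.
\<close>

lemma offset_derivatives:
  assumes B: "bertrand_offset I c e I\<^sub>1 c\<^sub>1 e\<^sub>1 \<phi>"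
    and O: "offset_dual_angle I c e c\<^sub>1 e\<^sub>1 \<phi> \<theta> \<theta>'"
    and s: "s \<in> I"
  defines "r \<equiv> deriv (inv_into I \<phi>) (\<phi> s)"
  shows "curve_deriv (central_normal e\<^sub>1) (\<phi> s) = r *\<^sub>R curve_deriv (central_normal e) s"
    and "\<exists>d. curve_deriv c\<^sub>1 (\<phi> s) =
      r *\<^sub>R (curve_deriv c s + \<theta>' s *\<^sub>R curve_deriv (central_normal e) s + d *\<^sub>R central_normal e s)"
proof -
  define t where "t = central_normal e"
  define w where "w = (\<lambda>u. c\<^sub>1 (\<phi> u) - c u)"
  define p where "p = deriv \<phi> s"
  have R: "ruled_surface I c e" and R1: "ruled_surface I\<^sub>1 c\<^sub>1 e\<^sub>1" and I: "open I"
    and s1: "\<phi> s \<in> I\<^sub>1"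
    using B s by (auto simp: bertrand_offset_def ruled_surface_def bij_betw_def)
  have rp: "r * p = 1"
    using offset_parameter_derivative(2)[OF B s] by (simp add: r_def p_def)
  have \<phi>: "(\<phi> has_vector_derivative p) (at s)"
    using offset_parameter_derivative(1)[OF B s]
    by (simp add: p_def has_real_derivative_iff_has_vector_derivative)
  note D = ruled_surface_has_derivs[OF R s, folded t_def]
  note D1 = ruled_surface_has_derivs[OF R1 s1]
  have "((central_normal e\<^sub>1 \<circ> \<phi>) has_vector_derivative
      p *\<^sub>R curve_deriv (central_normal e\<^sub>1) (\<phi> s)) (at s)"
    by (rule vector_diff_chain_at[OF \<phi> D1(3)])
  then have "(t has_vector_derivative p *\<^sub>R curve_deriv (central_normal e\<^sub>1) (\<phi> s)) (at s)"
    by (rule has_vector_derivative_transform_within_open[OF _ I s])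
      (simp add: offset_frame(1)[OF B O] t_def)
  then have "curve_deriv t s = p *\<^sub>R curve_deriv (central_normal e\<^sub>1) (\<phi> s)"
    by (rule vector_derivative_at)
  then show "curve_deriv (central_normal e\<^sub>1) (\<phi> s) = r *\<^sub>R curve_deriv (central_normal e) s"
    using rp by (simp add: t_def)
  have "((\<lambda>u. c\<^sub>1 (\<phi> u)) has_vector_derivative p *\<^sub>R curve_deriv c\<^sub>1 (\<phi> s)) (at s)"
    using vector_diff_chain_at[OF \<phi> D1(1)] by (simp add: o_def)
  then have w': "(w has_vector_derivative p *\<^sub>R curve_deriv c\<^sub>1 (\<phi> s) - curve_deriv c s) (at s)"
    unfolding w_def by (intro has_vector_derivative_diff D)
  have wu: "w u = \<theta>' u *\<^sub>R t u" and wt: "w u \<bullet> t u = \<theta>' u" if "u \<in> I" for u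
    using offset_frame(4)[OF B O that] ruled_surface_frame(2)[OF R that]
    by (simp_all add: w_def t_def)
  obtain d where d: "((\<lambda>u. w u \<bullet> t u) has_vector_derivative d) (at s)"
    using bounded_bilinear.has_vector_derivative[OF bounded_bilinear_inner w' D(3)] by blast
  have "(\<theta>' has_vector_derivative d) (at s)"
    by (rule has_vector_derivative_transform_within_open[OF d I s wt])
  then have "((\<lambda>u. \<theta>' u *\<^sub>R t u) has_vector_derivative (\<theta>' s *\<^sub>R curve_deriv t s + d *\<^sub>R t s)) (at s)"
    using D(3) has_vector_derivative_scaleR
    by (simp add: has_real_derivative_iff_has_vector_derivative)
  then have "(w has_vector_derivative (\<theta>' s *\<^sub>R curve_deriv t s + d *\<^sub>R t s)) (at s)"
    by (rule has_vector_derivative_transform_within_open[OF _ I s]) (simp add: wu)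
  then have "p *\<^sub>R curve_deriv c\<^sub>1 (\<phi> s) = curve_deriv c s + \<theta>' s *\<^sub>R curve_deriv t s + d *\<^sub>R t s"
    using vector_derivative_unique_at[OF w'] by (simp add: algebra_simps)
  then have "curve_deriv c\<^sub>1 (\<phi> s) = r *\<^sub>R (curve_deriv c s + \<theta>' s *\<^sub>R curve_deriv t s + d *\<^sub>R t s)"
    using rp by (metis scaleR_one scaleR_scaleR)
  then show "\<exists>d. curve_deriv c\<^sub>1 (\<phi> s) =
      r *\<^sub>R (curve_deriv c s + \<theta>' s *\<^sub>R curve_deriv (central_normal e) s + d *\<^sub>R central_normal e s)"
    by (auto simp: t_def)
qed

text \<open>
  All inner products are evaluated in the frame of the first surface, where \<open>t'\<close> has the
  components \<open>\<gamma>\<close> along \<open>g\<close> and \<open>-1\<close> along \<open>e\<close>, and \<open>c'\<close> has the components \<open>\<Delta>\<close> along \<open>g\<close>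
  and \<open>\<delta>\<close> along \<open>e\<close>.
\<close>

lemma offset_invariants:
  assumes B: "bertrand_offset I c e I\<^sub>1 c\<^sub>1 e\<^sub>1 \<phi>"
    and O: "offset_dual_angle I c e c\<^sub>1 e\<^sub>1 \<phi> \<theta> \<theta>'"
    and s: "s \<in> I"
  defines "r \<equiv> deriv (inv_into I \<phi>) (\<phi> s)"
    and "\<gamma> \<equiv> conical_curvature e s"
  shows "conical_curvature e\<^sub>1 (\<phi> s) = r * (\<gamma> * cos (\<theta> s) - sin (\<theta> s))"
    and "delta c\<^sub>1 e\<^sub>1 (\<phi> s) = r * (delta c e s * cos (\<theta> s) - Delta c e s * sin (\<theta> s)
           - \<theta>' s * (cos (\<theta> s) + \<gamma> * sin (\<theta> s)))"
    and "Delta c\<^sub>1 e\<^sub>1 (\<phi> s) = r * (delta c e s * sin (\<theta> s) + Delta c e s * cos (\<theta> s)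
           + \<theta>' s * (\<gamma> * cos (\<theta> s) - sin (\<theta> s)))"
proof -
  have R: "ruled_surface I c e" and R1: "ruled_surface I\<^sub>1 c\<^sub>1 e\<^sub>1" and s1: "\<phi> s \<in> I\<^sub>1"
    using B s by (auto simp: bertrand_offset_def bij_betw_def)
  note frame = offset_frame[OF B O s]
  note t' = conical_curvature_eq[OF R s, folded \<gamma>_def] ruled_surface_frame(5)[OF R s]
  have orth: "central_normal e s \<bullet> e s = 0" "central_normal e s \<bullet> asymptotic_normal e s = 0"
    using ruled_surface_frame(3)[OF R s]
    by (simp_all add: asymptotic_normal_def dot_cross_self inner_commute)
  note t1' = offset_derivatives(1)[OF B O s, folded r_def]
  obtain d where c1': "curve_deriv c\<^sub>1 (\<phi> s) = r *\<^sub>R (curve_deriv c s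
      + \<theta>' s *\<^sub>R curve_deriv (central_normal e) s + d *\<^sub>R central_normal e s)"
    using offset_derivatives(2)[OF B O s, folded r_def] by blast
  note inner = inner_add_left inner_add_right inner_diff_left inner_diff_right
  show "conical_curvature e\<^sub>1 (\<phi> s) = r * (\<gamma> * cos (\<theta> s) - sin (\<theta> s))"
    by (simp add: conical_curvature_eq[OF R1 s1] t1' frame(3) inner t' algebra_simps flip: t'(1))
  show "delta c\<^sub>1 e\<^sub>1 (\<phi> s) = r * (delta c e s * cos (\<theta> s) - Delta c e s * sin (\<theta> s)
           - \<theta>' s * (cos (\<theta> s) + \<gamma> * sin (\<theta> s)))"
    by (simp add: delta_def Delta_eq_inner c1' frame(2) inner orth t' algebra_simps flip: t'(1))
  show "Delta c\<^sub>1 e\<^sub>1 (\<phi> s) = r * (delta c e s * sin (\<theta> s) + Delta c e s * cos (\<theta> s)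
           + \<theta>' s * (\<gamma> * cos (\<theta> s) - sin (\<theta> s)))"
    by (simp add: delta_def Delta_eq_inner c1' frame(3) inner orth t' algebra_simps flip: t'(1))
qed

theorem theorem4p8:
  fixes c e c\<^sub>1 e\<^sub>1 :: "real \<Rightarrow> real^3" and \<phi> \<theta> \<theta>' :: "real \<Rightarrow> real"
    and I I\<^sub>1 :: "real set" and s ds_ds\<^sub>1 A B :: real
  assumes "bertrand_offset I c e I\<^sub>1 c\<^sub>1 e\<^sub>1 \<phi>"
    and "offset_dual_angle I c e c\<^sub>1 e\<^sub>1 \<phi> \<theta> \<theta>'"
    and "s \<in> I"
    and "ds_ds\<^sub>1 = deriv (inv_into I \<phi>) (\<phi> s)"
    and "A = ds_ds\<^sub>1 * (conical_curvature e s * cos (\<theta> s) - sin (\<theta> s))"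
    and "B = A * ds_ds\<^sub>1 *
           (- (sin (\<theta> s) + A * cos (\<theta> s)) * Delta c e s
            + (cos (\<theta> s) - A * sin (\<theta> s)) * delta c e s
            - (A * (conical_curvature e s * cos (\<theta> s) - sin (\<theta> s))
               + cos (\<theta> s) + conical_curvature e s * sin (\<theta> s)) * \<theta>' s)"
  shows "dual_curvature c\<^sub>1 e\<^sub>1 (\<phi> s) =
           Dual ((1 + A\<^sup>2) powr (- 1 / 2)) (- B * (1 + A\<^sup>2) powr (- 3 / 2))"
proof -
  have "A * (delta c\<^sub>1 e\<^sub>1 (\<phi> s) - A * Delta c\<^sub>1 e\<^sub>1 (\<phi> s)) = B"
    unfolding assms(6) offset_invariants(2,3)[OF assms(1-3)] assms(4)[symmetric]
    by (simp add: algebra_simps)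
  moreover have "conical_curvature e\<^sub>1 (\<phi> s) = A"
    using offset_invariants(1)[OF assms(1-3)] assms(4,5) by simp
  ultimately show ?thesis
    using dual_curvature_eq[of c\<^sub>1 e\<^sub>1 "\<phi> s"] by (simp add: dual_conical_curvature_def)
qed

end
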